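(* Let $G=\mathbb{Z}_p\times\mathbb{Z}_q$ for distinct primes $p$ and $q$, let $S$ be a proper subset of $G\setminus\{0\}$ that generates $G$, and let $S_0=S\cup\{0\}$. Let $0\in C\subseteq G$. Then $C$ is a perfect code in $\mathrm{Cay}(G,S)$ if and only if there are integers $\alpha_i$ with $\alpha_0=0$ such that $(S_0,C)$ is one of the following pairs: (1) $S_0=\{(i,\alpha_i)\mid i\in[p]\}$, $C=\{(0,i)\mid i\in[q]\}$; (2) $S_0=\{(\alpha_i,i)\mid i\in[q]\}$, $C=\{(i,0)\mid i\in[p]\}$.
   Context: Groups are finite abelian, written additively; $\mathbb{Z}_n$ is the group of integers modulo $n$ and $[n]=\{0,1,\dots,n-1\}$; integers appearing as coordinates are read modulo the relevant modulus. For $S\subseteq G\setminus\{0\}$, $\mathrm{Cay}(G,S)$ is the directed graph with vertex set $G$ and an arc from $x$ to $y$ if and only if $y-x\in S$ ($S$ is not assumed to be inverse-closed). A subset $C\subseteq G$ is a perfect code in $\mathrm{Cay}(G,S)$ if the sets $\{c\}\cup\{v:\text{there is an arc from } c \text{ to } v\}$, $c\in C$, form a partition of $G$. *)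

theory Defs
  imports
    "HOL-Algebra.Elementary_Groups"
    "HOL-Algebra.Generated_Groups"
    "HOL-Computational_Algebra.Primes"
    "HOL-Library.Disjoint_Sets"
    "Graph_Theory.Digraph"
begin

(* HOL-Algebra groups are written multiplicatively: y \<otimes> inv x is the difference y - x. *)
definition cayley_digraph :: "('a, 'm) monoid_scheme \<Rightarrow> 'a set \<Rightarrow> ('a, 'a \<times> 'a) pre_digraph"
  where "cayley_digraph G S =
    \<lparr>verts = carrier G,
     arcs = {(x, y). x \<in> carrier G \<and> y \<in> carrier G \<and> y \<otimes>\<^bsub>G\<^esub> inv\<^bsub>G\<^esub> x \<in> S},
     tail = fst, head = snd\<rparr>"

definition closed_out_neighbourhood :: "('a, 'b) pre_digraph \<Rightarrow> 'a \<Rightarrow> 'a set"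
  where "closed_out_neighbourhood D c = insert c {v. c \<rightarrow>\<^bsub>D\<^esub> v}"

(* The partition is that of an indexed family: distinct c must have disjoint closed
   out-neighbourhoods, so that every vertex is covered by exactly one c. The blocks are
   nonempty because each contains its index. *)
definition perfect_code :: "('a, 'b) pre_digraph \<Rightarrow> 'a set \<Rightarrow> bool"
  where "perfect_code D C \<longleftrightarrow>
    C \<subseteq> verts D \<and>
    disjoint_family_on (closed_out_neighbourhood D) C \<and>
    (\<Union>c\<in>C. closed_out_neighbourhood D c) = verts D"

(* The carrier is {0..<int p} \<times> {0..<int q} (for p, q > 0), with componentwise addition mod p, q. *)
abbreviation Z_prod :: "nat \<Rightarrow> nat \<Rightarrow> (int \<times> int) monoid"
  where "Z_prod p q \<equiv> integer_mod_group p \<times>\<times> integer_mod_group q"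

end

theory Submission
  imports Defs "HOL-Number_Theory.Cong"
begin

text \<open>
  The closed out-neighbourhood of \<open>c\<close> is \<open>S\<^sub>0 + c\<close>, so \<open>C\<close> is a perfect code exactly when
  \<open>(s, c) \<mapsto> s + c\<close> is a bijection from \<open>S\<^sub>0 \<times> C\<close> onto \<open>G\<close>, i.e. when \<open>G = S\<^sub>0 \<oplus> C\<close> is a
  factorization. That the listed pairs are factorizations is a direct computation: a transversal of
  a subgroup, together with this subgroup, factorizes the group.

  For the converse, the main tool is the replacement principle for a factorization \<open>G = A \<oplus> B\<close> of a
  finite abelian group: if \<open>k\<close> is coprime to \<open>|A|\<close>, then multiplication by \<open>k\<close> is injective on \<open>A\<close>
  and \<open>G = kA \<oplus> B\<close> is again a factorization (\<open>factorization_pow\<close>). It suffices to treat a prime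
  \<open>k\<close>. If some \<open>g\<close> were not of the form \<open>ka + b\<close>, then the cyclic shift would act without fixed
  points on the sequences \<open>(a\<^sub>1, \<dots>, a\<^sub>k)\<close> in \<open>A\<close> with \<open>g \<in> a\<^sub>1 + \<dots> + a\<^sub>k + B\<close>, so \<open>k\<close> would divide
  the number of these sequences. But \<open>a\<^sub>2, \<dots>, a\<^sub>k\<close> can be chosen freely and then determine
  \<open>a\<^sub>1\<close>, so that this number is \<open>|A|\<close> to the power \<open>k - 1\<close>, which is prime to \<open>k\<close>.

  Now let \<open>G = \<int>\<^sub>p \<times> \<int>\<^sub>q = A \<oplus> B\<close> with \<open>|A| = p\<close> and \<open>|B| = q\<close> (\<open>factorization_Z_prod_prime\<close>).
  Since multiplication by \<open>q\<close> kills the second coordinate and is injective on \<open>A\<close>, the elements of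
  \<open>A\<close> have distinct first coordinates; likewise those of \<open>B\<close> have distinct second coordinates.
  Suppose that \<open>a, a' \<in> A\<close> differ in the second coordinate and \<open>b, b' \<in> B\<close> in the first. Both
  coordinates of \<open>a - a'\<close> are then units, and the Chinese remainder theorem gives a \<open>k\<close>, prime to
  \<open>p\<close>, with \<open>k(a - a') = b - b'\<close>. So \<open>ka + b' = ka' + b\<close> contradicts the factorization
  \<open>G = kA \<oplus> B\<close>. Hence the second coordinate is constant on \<open>A\<close> or the first one is constant on \<open>B\<close>.

  Finally, \<open>|S\<^sub>0|\<close> is a divisor of \<open>pq\<close>, and it is neither \<open>1\<close> nor \<open>pq\<close>, as \<open>S\<close> generates \<open>G\<close> and
  is a proper subset of \<open>G - {0}\<close>. So \<open>{|S\<^sub>0|, |C|} = {p, q}\<close>. By the preceding paragraph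
  \<open>S\<^sub>0\<close> or \<open>C\<close> lies on a coordinate axis. It cannot be \<open>S\<^sub>0\<close>, because \<open>S\<close> generates \<open>G\<close>. Hence
  \<open>C\<close> is an axis, and \<open>S\<^sub>0\<close> is a graph over the other one.
\<close>

section \<open>Fixed points under a map of prime order\<close>

text \<open>If \<open>d * m\<close> is \<open>1\<close> modulo \<open>p\<close>, then \<open>m\<close> rounds of \<open>d\<close> steps amount to a single step.\<close>

lemma funpow_fixed_of_coprime:
  assumes "(f ^^ d) x = x" and "(f ^^ p) x = x" and "coprime d p" and "1 < p"
  shows "f x = x"
proof -
  obtain m where m: "[d * m = Suc 0] (mod p)"
    using cong_solve_coprime_nat[OF assms(3)] by blast
  have "(f ^^ (d * m)) x = x"
    using funpow_mod_eq[OF assms(1), of "d * m"] by simp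
  moreover have "(f ^^ (d * m mod p)) x = (f ^^ (d * m)) x"
    by (rule funpow_mod_eq[OF assms(2)])
  moreover have "d * m mod p = 1"
    using m \<open>1 < p\<close> by (simp add: cong_def)
  ultimately show ?thesis by simp
qed

text \<open>
  The orbits partition \<open>X\<close>, and each of them has exactly \<open>p\<close> elements: a coincidence of two of the
  first \<open>p\<close> iterates of a point would, \<open>p\<close> being prime, produce a fixed point.
\<close>

lemma prime_dvd_card_of_fixed_point_free:
  fixes p :: nat
  assumes "finite X" and "prime p"
    and closed: "\<And>x. x \<in> X \<Longrightarrow> f x \<in> X"
    and order: "\<And>x. x \<in> X \<Longrightarrow> (f ^^ p) x = x"
    and free: "\<And>x. x \<in> X \<Longrightarrow> f x \<noteq> x"
  shows "p dvd card X"
proof -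
  define orb where "orb x = (\<lambda>i. (f ^^ i) x) ` {..<p}" for x
  have p: "1 < p" using \<open>prime p\<close> prime_gt_1_nat by blast
  have iter_closed: "(f ^^ i) x \<in> X" if "x \<in> X" for i x
    using that by (induction i) (auto simp: closed)
  have orb_iter: "(f ^^ i) x \<in> orb x" if "x \<in> X" for i x
  proof -
    have "(f ^^ i) x = (f ^^ (i mod p)) x"
      using funpow_mod_eq[OF order[OF that]] by simp
    then show ?thesis using p by (auto simp: orb_def)
  qed
  have orb_eq: "orb y = orb x" if x: "x \<in> X" and y: "y \<in> orb x" for x y
  proof -
    obtain i where i: "i < p" "y = (f ^^ i) x" using y by (auto simp: orb_def)
    have yX: "y \<in> X" using i iter_closed x by simp
    \<comment> \<open>The iterates return to \<open>x\<close> from \<open>y\<close>, since \<open>f\<close> has order dividing \<open>p\<close>.\<close>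
    have x': "x = (f ^^ (p - i)) y"
      using i order[OF x] by (simp flip: funpow_add comp_apply[of "f ^^ (p - i)"])
    have "(f ^^ j) y \<in> orb x" for j
      using orb_iter[OF x, of "j + i"] i(2) by (simp add: funpow_add)
    then have "orb y \<subseteq> orb x" by (auto simp: orb_def[of y])
    moreover have "(f ^^ j) x \<in> orb y" for j
      using orb_iter[OF yX, of "j + (p - i)"] x' by (simp add: funpow_add)
    then have "orb x \<subseteq> orb y" by (auto simp: orb_def[of x])
    ultimately show ?thesis by blast
  qed
  have card_orb: "card (orb x) = p" if x: "x \<in> X" for x
  proof -
    have False if "i < j" "j < p" and eq: "(f ^^ i) x = (f ^^ j) x" for i j
    proof -
      let ?y = "(f ^^ i) x"
      have "(f ^^ (j - i)) ?y = ?y"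
        using that(1) eq funpow_add[of "j - i" i f] by simp
      moreover have "(f ^^ p) ?y = ?y" using order iter_closed x by simp
      moreover have "coprime (j - i) p"
      proof -
        have "\<not> p dvd j - i" using that(1,2) by (auto dest: dvd_imp_le)
        then show ?thesis using \<open>prime p\<close> by (simp add: coprime_commute prime_imp_coprime)
      qed
      ultimately have "f ?y = ?y" by (rule funpow_fixed_of_coprime[OF _ _ _ p])
      then show False using free iter_closed x by blast
    qed
    then have "inj_on (\<lambda>i. (f ^^ i) x) {..<p}"
      by (intro linorder_inj_onI) auto
    then show ?thesis by (simp add: orb_def card_image)
  qed
  have self: "x \<in> orb x" if "x \<in> X" for x using orb_iter[OF that, of 0] by simp
  have cover: "\<Union> (orb ` X) = X"
    using self iter_closed by (auto simp: orb_def)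
  have "p dvd card (\<Union> (orb ` X))"
  proof (rule dvd_partition)
    show "\<forall>c1\<in>orb ` X. \<forall>c2\<in>orb ` X. c1 \<noteq> c2 \<longrightarrow> c1 \<inter> c2 = {}"
      using orb_eq by blast
  qed (use cover \<open>finite X\<close> card_orb in auto)
  then show ?thesis by (simp add: cover)
qed

section \<open>Factorizations of abelian groups\<close>

definition factorization :: "('a, 'm) monoid_scheme \<Rightarrow> 'a set \<Rightarrow> 'a set \<Rightarrow> bool"
  where "factorization G A B \<longleftrightarrow> A \<subseteq> carrier G \<and> B \<subseteq> carrier G \<and>
    bij_betw (\<lambda>(a, b). a \<otimes>\<^bsub>G\<^esub> b) (A \<times> B) (carrier G)"

lemma card_factorization:
  "factorization G A B \<Longrightarrow> card A * card B = card (carrier G)"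
  by (metis bij_betw_same_card card_cartesian_product factorization_def)

lemma factorization_unique:
  assumes "factorization G A B" and "a \<in> A" "a' \<in> A" "b \<in> B" "b' \<in> B"
    and "a \<otimes>\<^bsub>G\<^esub> b = a' \<otimes>\<^bsub>G\<^esub> b'"
  shows "a = a' \<and> b = b'"
  using assms unfolding factorization_def bij_betw_def inj_on_def by fastforce

lemma factorization_obtain:
  assumes "factorization G A B" and "g \<in> carrier G"
  obtains a b where "a \<in> A" "b \<in> B" "a \<otimes>\<^bsub>G\<^esub> b = g"
proof -
  have "g \<in> (\<lambda>(a, b). a \<otimes>\<^bsub>G\<^esub> b) ` (A \<times> B)"
    using assms by (simp add: factorization_def bij_betw_def)
  then show thesis using that by auto
qed

context comm_group
begin

lemma factorization_commute:
  assumes "factorization G A B"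
  shows "factorization G B A"
proof -
  have "bij_betw ((\<lambda>(a, b). a \<otimes> b) \<circ> prod.swap) (B \<times> A) (carrier G)"
    using assms by (intro bij_betw_trans[where B = "A \<times> B"])
      (auto simp: factorization_def bij_betw_def inj_on_def)
  moreover have "((\<lambda>(a, b). a \<otimes> b) \<circ> prod.swap) x = (\<lambda>(a, b). a \<otimes> b) x"
    if "x \<in> B \<times> A" for x
    using that assms m_comm by (auto simp: factorization_def subset_iff)
  ultimately show ?thesis
    using assms by (simp add: factorization_def cong: bij_betw_cong)
qed

lemma foldr_mult_closed:
  "set xs \<subseteq> carrier G \<Longrightarrow> foldr (\<otimes>) xs \<one> \<in> carrier G"
  by (induction xs) auto

text \<open>
  Commutativity makes the product of a list invariant under rotation, which is the action that
  the counting argument below uses; its fixed points are the constant lists, with product \<open>a [^] k\<close>.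
\<close>

lemma foldr_mult_rotate1:
  assumes "set xs \<subseteq> carrier G"
  shows "foldr (\<otimes>) (rotate1 xs) \<one> = foldr (\<otimes>) xs \<one>"
proof (cases xs)
  case (Cons x ys)
  have *: "foldr (\<otimes>) ys y = y \<otimes> foldr (\<otimes>) ys \<one>"
    if "set ys \<subseteq> carrier G" "y \<in> carrier G" for y ys
    using that by (induction ys) (auto simp: foldr_mult_closed m_lcomm)
  from Cons assms have "foldr (\<otimes>) (rotate1 xs) \<one> = foldr (\<otimes>) ys x" by simp
  also have "\<dots> = foldr (\<otimes>) xs \<one>" using *[of ys x] Cons assms by simp
  finally show ?thesis .
qed simp

lemma foldr_mult_replicate:
  assumes "a \<in> carrier G"
  shows "foldr (\<otimes>) (replicate k a) \<one> = a [^] k"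
  using assms by (induction k) (auto simp: m_comm)

text \<open>
  The tail of the list is arbitrary and determines its head: the product of the tail, the
  head and some \<open>b \<in> B\<close> has to be \<open>g\<close>, and factorizing what the tail leaves over gives exactly one
  head and one \<open>b\<close>. So dropping the head is a bijection onto the lists of length \<open>n\<close>.
\<close>

lemma card_lists_completed_by_factor:
  assumes "finite (carrier G)" and F: "factorization G A B" and "g \<in> carrier G"
  shows "card {xs. set xs \<subseteq> A \<and> length xs = Suc n \<and> (\<exists>b\<in>B. foldr (\<otimes>) xs \<one> \<otimes> b = g)} = card A ^ n"
    (is "card ?X = _")
proof -
  have sub: "A \<subseteq> carrier G" "B \<subseteq> carrier G" using F by (auto simp: factorization_def)
  have solve: "foldr (\<otimes>) (x # ys) \<one> \<otimes> b = g \<longleftrightarrow> x \<otimes> b = inv (foldr (\<otimes>) ys \<one>) \<otimes> g"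
    if "x \<in> A" "set ys \<subseteq> A" "b \<in> B" for x ys b
  proof -
    have "foldr (\<otimes>) ys \<one> \<in> carrier G" "x \<in> carrier G" "b \<in> carrier G"
      using that sub foldr_mult_closed by auto
    then show ?thesis
      using \<open>g \<in> carrier G\<close> inv_solve_left[of "x \<otimes> b" "foldr (\<otimes>) ys \<one>" g]
      by (auto simp: m_ac)
  qed
  have "bij_betw tl ?X {ys. set ys \<subseteq> A \<and> length ys = n}"
  proof (rule bij_betw_imageI)
    show "inj_on tl ?X"
    proof (rule inj_onI)
      fix xs xs' assume "xs \<in> ?X" "xs' \<in> ?X" and tl: "tl xs = tl xs'"
      then obtain x x' ys b b' where *: "xs = x # ys" "xs' = x' # ys" "b \<in> B" "b' \<in> B"
        "x \<in> A" "x' \<in> A" "set ys \<subseteq> A"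
        "foldr (\<otimes>) xs \<one> \<otimes> b = g" "foldr (\<otimes>) xs' \<one> \<otimes> b' = g"
        by (cases xs; cases xs'; auto)
      then have "x \<otimes> b = x' \<otimes> b'" using solve by metis
      then show "xs = xs'" using * factorization_unique[OF F] by blast
    qed
    show "tl ` ?X = {ys. set ys \<subseteq> A \<and> length ys = n}"
    proof (intro subset_antisym subsetI)
      fix ys assume "ys \<in> {ys. set ys \<subseteq> A \<and> length ys = n}"
      then have ys: "set ys \<subseteq> A" "length ys = n" by auto
      have "inv (foldr (\<otimes>) ys \<one>) \<otimes> g \<in> carrier G"
        using ys sub \<open>g \<in> carrier G\<close> foldr_mult_closed by auto
      then obtain x b where "x \<in> A" "b \<in> B" "x \<otimes> b = inv (foldr (\<otimes>) ys \<one>) \<otimes> g"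
        using factorization_obtain[OF F] by blast
      then have "x # ys \<in> ?X" using solve ys by auto
      then show "ys \<in> tl ` ?X" by (rule rev_image_eqI) simp
    next
      fix ys assume "ys \<in> tl ` ?X"
      then obtain xs where "xs \<in> ?X" "ys = tl xs" by blast
      then show "ys \<in> {ys. set ys \<subseteq> A \<and> length ys = n}" by (cases xs) auto
    qed
  qed
  then have "card ?X = card {ys. set ys \<subseteq> A \<and> length ys = n}" by (rule bij_betw_same_card)
  also have "\<dots> = card A ^ n"
    using assms(1) sub(1) by (intro card_lists_length_eq) (auto intro: finite_subset)
  finally show ?thesis .
qed

text \<open>
  This is the Frobenius identity \<open>(\<Sum>a)\<^sup>k = \<Sum>a\<^sup>k\<close> of the group ring modulo \<open>k\<close> in combinatorial
  form: rotation matches up, in orbits of \<open>k\<close>, all lists but the constant ones. Surjectivity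
  onto the group is what counting yields; injectivity follows because \<open>A \<times> B\<close> and the group have
  the same finite size.
\<close>

lemma factorization_pow_prime:
  fixes k :: nat
  assumes fin: "finite (carrier G)" and F: "factorization G A B"
    and "prime k" and "\<not> k dvd card A"
  shows "inj_on (\<lambda>a. a [^] k) A \<and> factorization G ((\<lambda>a. a [^] k) ` A) B"
proof -
  have sub: "A \<subseteq> carrier G" "B \<subseteq> carrier G" using F by (auto simp: factorization_def)
  have finA: "finite A" "finite B" using fin sub finite_subset by blast+
  have surj: "\<exists>a\<in>A. \<exists>b\<in>B. a [^] k \<otimes> b = g" if g: "g \<in> carrier G" for g
  proof (rule ccontr)
    assume none: "\<not> (\<exists>a\<in>A. \<exists>b\<in>B. a [^] k \<otimes> b = g)"
    obtain n where k: "k = Suc n" using prime_gt_0_nat[OF \<open>prime k\<close>] by (cases k) auto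
    define X where "X = {xs. set xs \<subseteq> A \<and> length xs = k \<and> (\<exists>b\<in>B. foldr (\<otimes>) xs \<one> \<otimes> b = g)}"
    have "k dvd card X"
    proof (rule prime_dvd_card_of_fixed_point_free[where f = rotate1])
      show "finite X"
        by (rule finite_subset[OF _ finite_lists_length_eq[OF finA(1), of k]]) (auto simp: X_def)
      show "rotate1 xs \<in> X" if "xs \<in> X" for xs
        using that sub foldr_mult_rotate1[of xs] by (auto simp: X_def)
      show "(rotate1 ^^ k) xs = xs" if "xs \<in> X" for xs
        using that rotate_id[of k xs] by (auto simp: X_def rotate_def[symmetric])
      show "rotate1 xs \<noteq> xs" if "xs \<in> X" for xs
      proof
        assume "rotate1 xs = xs"
        moreover have "xs \<noteq> []" using that k by (auto simp: X_def)
        ultimately obtain a where "set xs = {a}"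
          using rotate1_fixpoint_card card_1_singletonE by metis
        then have "xs = replicate k a" "a \<in> A"
          using that replicate_eqI[of xs k a] by (auto simp: X_def)
        then have "foldr (\<otimes>) xs \<one> = a [^] k"
          using sub foldr_mult_replicate by blast
        then show False using that none \<open>a \<in> A\<close> by (auto simp: X_def)
      qed
    qed fact
    moreover have "card X = card A ^ n"
      unfolding X_def k by (rule card_lists_completed_by_factor[OF fin F g])
    ultimately show False
      using \<open>prime k\<close> \<open>\<not> k dvd card A\<close> prime_dvd_power by metis
  qed
  let ?f = "\<lambda>(a, b). a [^] k \<otimes> b"
  have im: "?f ` (A \<times> B) = carrier G"
    using surj sub by (force simp: subset_iff)
  moreover have "card (carrier G) = card (A \<times> B)"
    using card_factorization[OF F] by (simp add: card_cartesian_product)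
  ultimately have inj: "inj_on ?f (A \<times> B)"
    using finA by (intro eq_card_imp_inj_on) auto
  obtain b where "b \<in> B" using surj[OF one_closed] by blast
  then have "inj_on (\<lambda>a. a [^] k) A"
    using inj by (auto simp: inj_on_def)
  moreover have "bij_betw (\<lambda>(a, b). a \<otimes> b) ((\<lambda>a. a [^] k) ` A \<times> B) (carrier G)"
    unfolding bij_betw_def
  proof
    show "inj_on (\<lambda>(a, b). a \<otimes> b) ((\<lambda>a. a [^] k) ` A \<times> B)"
      using inj unfolding inj_on_def by fastforce
    show "(\<lambda>(a, b). a \<otimes> b) ` ((\<lambda>a. a [^] k) ` A \<times> B) = carrier G"
      unfolding im[symmetric] by auto
  qed
  ultimately show ?thesis
    using sub by (auto simp: factorization_def)
qed

text \<open>
  One prime factor of \<open>k\<close> is treated at a time; this is possible since the replaced set has the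
  same number of elements as \<open>A\<close>, hence is still coprime in size to the remaining factors.
\<close>

lemma factorization_pow:
  fixes k :: nat
  assumes fin: "finite (carrier G)" and "factorization G A B"
    and "coprime k (card A)" and "0 < k"
  shows "inj_on (\<lambda>a. a [^] k) A \<and> factorization G ((\<lambda>a. a [^] k) ` A) B"
  using assms(2-)
proof (induction k arbitrary: A rule: prime_divisors_induct)
  case (unit k)
  have "(\<lambda>a. a [^] k) ` A = A" "inj_on (\<lambda>a. a [^] k) A"
    using unit by (auto simp: factorization_def inj_on_def subset_iff intro: rev_image_eqI)
  then show ?case using unit by simp
next
  case (factor p k)
  let ?A = "(\<lambda>a. a [^] k) ` A"
  have 1: "inj_on (\<lambda>a. a [^] k) A" "factorization G ?A B"
    using factor.IH[of A] factor.prems by auto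
  then have "\<not> p dvd card ?A"
    using factor by (auto simp: card_image prime_nat_iff coprime_absorb_left)
  with factorization_pow_prime[OF fin 1(2) factor.hyps]
  have 2: "inj_on (\<lambda>a. a [^] p) ?A" "factorization G ((\<lambda>a. a [^] p) ` ?A) B" by auto
  have pow: "a [^] (p * k) = (a [^] k) [^] p" if "a \<in> A" for a
    using that factor.prems(1) by (auto simp: factorization_def nat_pow_pow mult.commute subset_iff)
  have "(\<lambda>a. a [^] p) ` ?A = (\<lambda>a. a [^] (p * k)) ` A"
    using pow by (auto simp: image_image)
  moreover have "inj_on (\<lambda>a. a [^] (p * k)) A"
    using comp_inj_on[OF 1(1) 2(1)] pow by (simp add: inj_on_def)
  ultimately show ?case using 2(2) by simp
qed simp

text \<open>
  The closed out-neighbourhoods are the translates of \<open>insert \<one> S\<close> by the elements of \<open>C\<close>. That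
  they are disjoint is injectivity of the multiplication map, that they cover is surjectivity.
\<close>

lemma perfect_code_cayley_digraph_iff:
  assumes "S \<subseteq> carrier G" and "C \<subseteq> carrier G"
  shows "perfect_code (cayley_digraph G S) C \<longleftrightarrow> factorization G (insert \<one> S) C"
proof -
  let ?D = "cayley_digraph G S" and ?S = "insert \<one> S"
  have nbhd: "closed_out_neighbourhood ?D c = (\<lambda>s. s \<otimes> c) ` ?S" if "c \<in> C" for c
  proof -
    have c: "c \<in> carrier G" using that assms by blast
    have "c \<rightarrow>\<^bsub>?D\<^esub> v \<longleftrightarrow> v \<in> (\<lambda>s. s \<otimes> c) ` S" for v
    proof -
      have "c \<rightarrow>\<^bsub>?D\<^esub> v \<longleftrightarrow> v \<in> carrier G \<and> v \<otimes> inv c \<in> S"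
        using c by (auto simp: arcs_ends_conv cayley_digraph_def image_iff)
      also have "\<dots> \<longleftrightarrow> v \<in> (\<lambda>s. s \<otimes> c) ` S"
      proof
        assume "v \<in> carrier G \<and> v \<otimes> inv c \<in> S"
        then show "v \<in> (\<lambda>s. s \<otimes> c) ` S"
          using c by (intro image_eqI[of _ _ "v \<otimes> inv c"]) (auto simp: m_assoc)
      next
        assume "v \<in> (\<lambda>s. s \<otimes> c) ` S"
        then show "v \<in> carrier G \<and> v \<otimes> inv c \<in> S"
          using c assms(1) by (auto simp: m_assoc subset_iff)
      qed
      finally show ?thesis .
    qed
    then show ?thesis using c by (auto simp: closed_out_neighbourhood_def)
  qed
  have "disjoint_family_on (closed_out_neighbourhood ?D) C \<longleftrightarrow> inj_on (\<lambda>(s, c). s \<otimes> c) (?S \<times> C)"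
    (is "?disjoint \<longleftrightarrow> ?inj")
  proof
    assume disj: ?disjoint
    show ?inj
    proof (rule inj_onI, clarify)
      fix s c s' c' assume *: "s \<in> ?S" "s' \<in> ?S" "c \<in> C" "c' \<in> C" "s \<otimes> c = s' \<otimes> c'"
      have "s \<otimes> c \<in> closed_out_neighbourhood ?D c"
        using *(1) nbhd[OF *(3)] by blast
      moreover have "s \<otimes> c \<in> closed_out_neighbourhood ?D c'"
        using *(2,5) nbhd[OF *(4)] by blast
      ultimately have "c = c'"
        using disj *(3,4) unfolding disjoint_family_on_def by blast
      moreover from this have "s = s'"
        using * assms by (intro right_cancel[THEN iffD1, of c s s']) auto
      ultimately show "s = s' \<and> c = c'" by simp
    qed
  next
    assume inj: ?inj
    have "c = c'" if "c \<in> C" "c' \<in> C" "s \<in> ?S" "s' \<in> ?S" "s \<otimes> c = s' \<otimes> c'" for c c' s s'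
      using inj_onD[OF inj, of "(s, c)" "(s', c')"] that by auto
    then show ?disjoint
      unfolding disjoint_family_on_def by (auto simp: nbhd simp del: image_insert)
  qed
  moreover have "(\<Union>c\<in>C. closed_out_neighbourhood ?D c) = (\<lambda>(s, c). s \<otimes> c) ` (?S \<times> C)"
    by (auto simp: nbhd)
  ultimately show ?thesis
    using assms by (simp add: perfect_code_def factorization_def bij_betw_def cayley_digraph_def)
qed

end

section \<open>Factorizations of the product of two cyclic groups of prime order\<close>

lemma comm_group_Z_prod: "comm_group (Z_prod p q)"
  by (rule group.group_comm_groupI) (auto intro: DirProd_group simp: add.commute)

lemma pow_Z_prod:
  "x [^]\<^bsub>Z_prod p q\<^esub> (k::nat) = (int k * fst x mod int p, int k * snd x mod int q)"
proof (induction k)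
  case 0
  then show ?case by (simp add: nat_pow_def)
next
  case (Suc k)
  then show ?case
    by (simp add: nat_pow_def mult_DirProd' mod_add_right_eq algebra_simps)
qed

lemma cong_solve_coprime_pair:
  fixes u v x y m n :: int
  assumes "coprime m n" and "coprime u m" and "coprime v n"
  obtains k where "[k * u = x] (mod m)" and "[k * v = y] (mod n)"
proof -
  obtain u' v' where inv: "[u * u' = 1] (mod m)" "[v * v' = 1] (mod n)"
    using assms(2,3) cong_solve_coprime_int by meson
  obtain k where k: "[k = x * u'] (mod m)" "[k = y * v'] (mod n)"
    using binary_chinese_remainder_int[OF assms(1)] by blast
  have "[k * u = x * (u * u')] (mod m)"
    using cong_mult[OF k(1) cong_refl[of u m]] by (simp add: mult_ac)
  also have "[x * (u * u') = x] (mod m)"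
    using cong_mult[OF cong_refl[of x m] inv(1)] by simp
  finally have 1: "[k * u = x] (mod m)" .
  have "[k * v = y * (v * v')] (mod n)"
    using cong_mult[OF k(2) cong_refl[of v n]] by (simp add: mult_ac)
  also have "[y * (v * v') = y] (mod n)"
    using cong_mult[OF cong_refl[of y n] inv(2)] by simp
  finally show thesis using 1 that by blast
qed

lemma not_dvd_diff_of_residues:
  fixes x y m :: int
  assumes "x \<in> {0..<m}" and "y \<in> {0..<m}" and "x \<noteq> y"
  shows "\<not> m dvd x - y"
  using assms by (metis atLeastLessThan_iff mod_eq_dvd_iff mod_pos_pos_trivial)

text \<open>
  Either part can play the role of \<open>S\<^sub>0\<close>, according to whether \<open>|S\<^sub>0|\<close> is \<open>p\<close> or \<open>q\<close>; this is why
  the conclusion treats both parts alike. The proof is the one outlined at the beginning, by the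
  replacement principle with the multipliers \<open>q\<close> for \<open>A\<close>, \<open>p\<close> for \<open>B\<close>, and one from the Chinese
  remainder theorem.
\<close>

lemma factorization_Z_prod_prime:
  fixes p q :: nat
  assumes "prime p" and "prime q" and "p \<noteq> q"
    and F: "factorization (Z_prod p q) A B" and "card A = p" and "card B = q"
  shows "inj_on fst A \<and> inj_on snd B \<and>
    ((\<forall>a\<in>A. \<forall>a'\<in>A. snd a = snd a') \<or> (\<forall>b\<in>B. \<forall>b'\<in>B. fst b = fst b'))"
proof -
  interpret comm_group "Z_prod p q" by (rule comm_group_Z_prod)
  have pos: "0 < p" "0 < q" using assms prime_gt_0_nat by auto
  have coprime: "coprime p q" using assms primes_coprime by blast
  have fin: "finite (carrier (Z_prod p q))" by (simp add: carrier_integer_mod_group pos)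
  have sub: "A \<subseteq> {0..<int p} \<times> {0..<int q}" "B \<subseteq> {0..<int p} \<times> {0..<int q}"
    using F pos by (simp_all add: factorization_def carrier_integer_mod_group)
  \<comment> \<open>The power \<open>q\<close> erases the second coordinate, and it is injective on \<open>A\<close> because \<open>|A| = p\<close>.\<close>
  have inj_A: "inj_on fst A"
  proof -
    have "inj_on (\<lambda>a. a [^]\<^bsub>Z_prod p q\<^esub> q) A"
      using factorization_pow[OF fin F, of q] coprime pos \<open>card A = p\<close> by (simp add: coprime_commute)
    then show ?thesis by (simp add: pow_Z_prod inj_on_def)
  qed
  have inj_B: "inj_on snd B"
  proof -
    have "inj_on (\<lambda>b. b [^]\<^bsub>Z_prod p q\<^esub> p) B"
      using factorization_pow[OF fin factorization_commute[OF F], of p] coprime pos \<open>card B = q\<close>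
      by simp
    then show ?thesis by (simp add: pow_Z_prod inj_on_def)
  qed
  have False if a: "a \<in> A" "a' \<in> A" "snd a \<noteq> snd a'" and b: "b \<in> B" "b' \<in> B" "fst b \<noteq> fst b'"
    for a a' b b'
  proof -
    have "fst a \<noteq> fst a'" using inj_A a by (metis inj_onD)
    then have "\<not> int p dvd fst a - fst a'"
      using a sub by (intro not_dvd_diff_of_residues) auto
    then have "coprime (fst a - fst a') (int p)"
      using \<open>prime p\<close> by (simp add: coprime_commute prime_imp_coprime)
    moreover have "\<not> int q dvd snd a - snd a'"
      using a sub by (intro not_dvd_diff_of_residues) auto
    then have "coprime (snd a - snd a') (int q)"
      using \<open>prime q\<close> by (simp add: coprime_commute prime_imp_coprime)
    moreover have "coprime (int p) (int q)" using coprime by simp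
    ultimately obtain l where l: "[l * (fst a - fst a') = fst b - fst b'] (mod int p)"
      "[l * (snd a - snd a') = snd b - snd b'] (mod int q)"
      using cong_solve_coprime_pair by blast
    define k where "k = nat (l mod (int p * int q))"
    have "int k = l mod (int p * int q)" using pos by (simp add: k_def)
    then have "[int k = l] (mod int p)" "[int k = l] (mod int q)"
      by (auto simp: cong_def mod_mod_cancel)
    then have k: "[int k * (fst a - fst a') = fst b - fst b'] (mod int p)"
      "[int k * (snd a - snd a') = snd b - snd b'] (mod int q)"
      using l cong_mult[OF _ cong_refl] cong_trans by meson+
    \<comment> \<open>This multiplier is prime to \<open>p\<close> because the first coordinates of \<open>b\<close> and \<open>b'\<close> differ;
      this allows replacing \<open>A\<close> by its \<open>k\<close>-th powers.\<close>
    have "\<not> int p dvd fst b - fst b'"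
      using b sub by (intro not_dvd_diff_of_residues) auto
    then have "\<not> int p dvd int k"
      using k(1) by (meson cong_dvd_iff dvd_mult2)
    then have "coprime k p" "0 < k"
      using prime_imp_coprime[OF \<open>prime p\<close>, of k] by (auto simp: coprime_commute intro: gr0I)
    then have F': "factorization (Z_prod p q) ((\<lambda>a. a [^]\<^bsub>Z_prod p q\<^esub> k) ` A) B"
      using factorization_pow[OF fin F] \<open>card A = p\<close> by simp
    have rearrange: "[n * x + y' = n * x' + y] (mod m)" if "[n * (x - x') = y - y'] (mod m)"
      for n x x' y y' m :: int
      using cong_add[OF that cong_refl[of "n * x' + y'"]] by (simp add: algebra_simps)
    have "[int k * fst a + fst b' = int k * fst a' + fst b] (mod int p)"
      "[int k * snd a + snd b' = int k * snd a' + snd b] (mod int q)"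
      using k[THEN rearrange] by simp_all
    then have "a [^]\<^bsub>Z_prod p q\<^esub> k \<otimes>\<^bsub>Z_prod p q\<^esub> b' = a' [^]\<^bsub>Z_prod p q\<^esub> k \<otimes>\<^bsub>Z_prod p q\<^esub> b"
      by (simp add: pow_Z_prod mult_DirProd' cong_def mod_add_left_eq)
    then have "b' = b"
      using factorization_unique[OF F'] a b by blast
    then show False using b by simp
  qed
  then show ?thesis using inj_A inj_B by blast
qed

lemma generate_Z_prod_ne_carrier:
  assumes "1 < p" and "1 < q" and "S \<subseteq> carrier (Z_prod p q)"
    and "(\<forall>s\<in>S. fst s = 0) \<or> (\<forall>s\<in>S. snd s = 0)"
  shows "generate (Z_prod p q) S \<noteq> carrier (Z_prod p q)"
proof -
  interpret comm_group "Z_prod p q" by (rule comm_group_Z_prod)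
  let ?P = "integer_mod_group p" and ?Q = "integer_mod_group q"
  have P: "subgroup (carrier ?P \<times> {0}) (Z_prod p q)"
    using DirProd_subgroups[OF group_integer_mod_group group.subgroup_self group_integer_mod_group
        group.triv_subgroup, of p q] by simp
  have Q: "subgroup ({0} \<times> carrier ?Q) (Z_prod p q)"
    using DirProd_subgroups[OF group_integer_mod_group group.triv_subgroup group_integer_mod_group
        group.subgroup_self, of p q] by simp
  have "S \<subseteq> {0} \<times> carrier ?Q \<or> S \<subseteq> carrier ?P \<times> {0}"
    using assms(4) by (elim disj_forward) (use assms(3) in \<open>auto simp: mem_Times_iff subset_iff\<close>)
  then have "generate (Z_prod p q) S \<subseteq> {0} \<times> carrier ?Q \<or>
      generate (Z_prod p q) S \<subseteq> carrier ?P \<times> {0}"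
    by (elim disj_forward) (rule generate_subgroup_incl[OF _ Q] generate_subgroup_incl[OF _ P], assumption)+
  then have "(1, 1) \<notin> generate (Z_prod p q) S" by auto
  moreover have "(1, 1) \<in> carrier (Z_prod p q)"
    using assms(1,2) by simp
  ultimately show ?thesis by metis
qed

text \<open>
  Counting turns injectivity of the projection into bijectivity onto all residues, so that \<open>T\<close> is
  the graph of a function.
\<close>

lemma graph_of_inj_on_fst:
  assumes "T \<subseteq> {0..<int m} \<times> {0..<int n}" and "(0, 0) \<in> T"
    and inj: "inj_on fst T" and "card T = m"
  shows "\<exists>\<alpha> :: nat \<Rightarrow> int. \<alpha> 0 = 0 \<and> T = {(int i, \<alpha> i mod int n) | i. i < m}"
proof (intro exI conjI)
  let ?\<alpha> = "\<lambda>i. snd (inv_into T fst (int i))"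
  have fst_T: "fst ` T = {0..<int m}"
  proof (rule card_subset_eq)
    show "card (fst ` T) = card {0..<int m}" using assms by (simp add: card_image)
  qed (use assms(1) in auto)
  have \<alpha>: "?\<alpha> (nat (fst t)) = snd t" if "t \<in> T" for t
    using that assms(1) inv_into_f_f[OF inj that] by auto
  show "?\<alpha> 0 = 0" using \<alpha>[OF assms(2)] by simp
  show "T = {(int i, ?\<alpha> i mod int n) | i. i < m}"
  proof (intro subset_antisym subsetI)
    fix t assume t: "t \<in> T"
    then have "t = (int (nat (fst t)), ?\<alpha> (nat (fst t)) mod int n)" "nat (fst t) < m"
      using assms(1) \<alpha>[OF t] by (auto simp: nat_less_iff)
    then show "t \<in> {(int i, ?\<alpha> i mod int n) | i. i < m}" by blast
  next
    fix t assume "t \<in> {(int i, ?\<alpha> i mod int n) | i. i < m}"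
    then obtain i where i: "i < m" "t = (int i, ?\<alpha> i mod int n)" by blast
    then have "int i \<in> fst ` T" by (simp add: fst_T)
    then obtain s where "s \<in> T" "fst s = int i" by auto
    then have "s = t" using \<alpha>[of s] i assms(1) by (auto simp: prod_eq_iff)
    then show "t \<in> T" using \<open>s \<in> T\<close> by simp
  qed
qed

lemma graph_of_inj_on_snd:
  assumes "T \<subseteq> {0..<int m} \<times> {0..<int n}" and "(0, 0) \<in> T"
    and "inj_on snd T" and "card T = n"
  shows "\<exists>\<alpha> :: nat \<Rightarrow> int. \<alpha> 0 = 0 \<and> T = {(\<alpha> i mod int m, int i) | i. i < n}"
proof -
  have "\<exists>\<alpha> :: nat \<Rightarrow> int. \<alpha> 0 = 0 \<and> prod.swap ` T = {(int i, \<alpha> i mod int m) | i. i < n}"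
  proof (rule graph_of_inj_on_fst)
    show "inj_on fst (prod.swap ` T)" using assms(3) by (auto simp: inj_on_def)
    show "card (prod.swap ` T) = n" using assms(4) by (simp add: card_image)
  qed (use assms(1,2) in force)+
  then obtain \<alpha> :: "nat \<Rightarrow> int" where \<alpha>: "\<alpha> 0 = 0"
    "prod.swap ` T = {(int i, \<alpha> i mod int m) | i. i < n}" by blast
  have "T = prod.swap ` prod.swap ` T" by (simp add: image_image)
  also have "\<dots> = {(\<alpha> i mod int m, int i) | i. i < n}" unfolding \<alpha>(2) by force
  finally show ?thesis using \<alpha>(1) by blast
qed

section \<open>Perfect codes in Cayley digraphs of the product\<close>

lemma mod_add_diff_cancel_left:
  "(a mod m + b - a) mod m = b mod m" for a b m :: int
  by (metis add_diff_cancel_left' mod_add_left_eq mod_diff_left_eq)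

lemma factorization_graph_fst:
  assumes "0 < p" and "0 < q"
  shows "factorization (Z_prod p q) {(int i, \<alpha> i mod int q) | i. i < p} {(0, int i) | i. i < q}"
    (is "factorization _ ?A ?B")
proof -
  have "bij_betw (\<lambda>(a, b). a \<otimes>\<^bsub>Z_prod p q\<^esub> b) (?A \<times> ?B) ({0..<int p} \<times> {0..<int q})"
    using assms
    by (intro bij_betw_byWitness[where f' =
          "\<lambda>(x, y). ((x, \<alpha> (nat x) mod int q), (0, (y - \<alpha> (nat x)) mod int q))"])
      (auto simp: mod_simps mod_add_diff_cancel_left nat_less_iff intro!: exI[of _ "nat _"])
  then show ?thesis using assms by (auto simp: factorization_def carrier_integer_mod_group)
qed

lemma factorization_graph_snd:
  assumes "0 < p" and "0 < q"
  shows "factorization (Z_prod p q) {(\<alpha> i mod int p, int i) | i. i < q} {(int i, 0) | i. i < p}"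
    (is "factorization _ ?A ?B")
proof -
  have "bij_betw (\<lambda>(a, b). a \<otimes>\<^bsub>Z_prod p q\<^esub> b) (?A \<times> ?B) ({0..<int p} \<times> {0..<int q})"
    using assms
    by (intro bij_betw_byWitness[where f' =
          "\<lambda>(x, y). ((\<alpha> (nat y) mod int p, y), ((x - \<alpha> (nat y)) mod int p, 0))"])
      (auto simp: mod_simps mod_add_diff_cancel_left nat_less_iff intro!: exI[of _ "nat _"])
  then show ?thesis using assms by (auto simp: factorization_def carrier_integer_mod_group)
qed

theorem theorem3p3:
  fixes p q :: nat and S S\<^sub>0 C :: "(int \<times> int) set"
  defines "G \<equiv> Z_prod p q"
  assumes "prime p" and "prime q" and "p \<noteq> q"
    and "S \<subset> carrier G - {\<one>\<^bsub>G\<^esub>}"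
    and "generate G S = carrier G"
    and "S\<^sub>0 = S \<union> {\<one>\<^bsub>G\<^esub>}"
    and "\<one>\<^bsub>G\<^esub> \<in> C" and "C \<subseteq> carrier G"
  shows "perfect_code (cayley_digraph G S) C \<longleftrightarrow>
    (\<exists>\<alpha> :: nat \<Rightarrow> int. \<alpha> 0 = 0 \<and>
      (S\<^sub>0 = {(int i, \<alpha> i mod int q) | i. i < p} \<and> C = {(0, int i) | i. i < q} \<or>
       S\<^sub>0 = {(\<alpha> i mod int p, int i) | i. i < q} \<and> C = {(int i, 0) | i. i < p}))"
    (is "_ \<longleftrightarrow> ?graph")
proof -
  interpret comm_group G unfolding G_def by (rule comm_group_Z_prod)
  have gt1: "1 < p" "1 < q" using assms prime_gt_1_nat by auto
  then have pos: "0 < p" "0 < q" by auto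
  have carr: "carrier G = {0..<int p} \<times> {0..<int q}" and one: "\<one>\<^bsub>G\<^esub> = (0, 0)"
    by (auto simp: G_def carrier_integer_mod_group pos)
  have sub: "S\<^sub>0 \<subset> carrier G" and S: "S \<subseteq> carrier G"
    using assms by auto
  have "perfect_code (cayley_digraph G S) C \<longleftrightarrow> factorization G S\<^sub>0 C"
    using perfect_code_cayley_digraph_iff[OF S] assms by simp
  also have "\<dots> \<longleftrightarrow> ?graph"
  proof
    assume ?graph
    then show "factorization G S\<^sub>0 C"
      using factorization_graph_fst[OF pos] factorization_graph_snd[OF pos] unfolding G_def by auto
  next
    assume F: "factorization G S\<^sub>0 C"
    have fin: "finite (carrier G)" by (simp add: carr)
    have prod: "card S\<^sub>0 * card C = p * q"
      using card_factorization[OF F] by (simp add: carr)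
    \<comment> \<open>Each axis is a proper subgroup, so it cannot contain the generating set.\<close>
    have not_axis: "\<not> (\<forall>s\<in>S\<^sub>0. fst s = 0)" "\<not> (\<forall>s\<in>S\<^sub>0. snd s = 0)"
      using generate_Z_prod_ne_carrier[OF gt1, of S] S assms by (auto simp: G_def)
    have zero: "(0, 0) \<in> S\<^sub>0" "(0, 0) \<in> C" using assms one by auto
    have "card S\<^sub>0 < p * q"
      using psubset_card_mono[OF fin sub] by (simp add: carr)
    moreover have "card S\<^sub>0 \<noteq> 1"
      using zero not_axis by (auto simp: card_1_singleton_iff)
    moreover obtain b c where "card S\<^sub>0 = b * c" "b dvd p" "c dvd q"
      using division_decomp[of "card S\<^sub>0" p q] prod by (metis dvd_triv_left)
    moreover from this have "b = 1 \<or> b = p" "c = 1 \<or> c = q"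
      using \<open>prime p\<close> \<open>prime q\<close> by (auto simp: prime_nat_iff)
    ultimately have "card S\<^sub>0 = p \<or> card S\<^sub>0 = q" by auto
    then show ?graph
    proof
      assume S\<^sub>0_p: "card S\<^sub>0 = p"
      then have C_q: "card C = q" using prod pos by simp
      have "inj_on fst S\<^sub>0"
        "(\<forall>s\<in>S\<^sub>0. \<forall>s'\<in>S\<^sub>0. snd s = snd s') \<or> (\<forall>c\<in>C. \<forall>c'\<in>C. fst c = fst c')"
        using factorization_Z_prod_prime[OF assms(2-4) F[unfolded G_def] S\<^sub>0_p C_q] by blast+
      moreover from this(2) have "\<forall>c\<in>C. fst c = 0"
        using zero not_axis(2) by (metis fst_conv snd_conv)
      moreover have "C = {0} \<times> {0..<int q}"
      proof (rule card_subset_eq)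
        show "C \<subseteq> {0} \<times> {0..<int q}"
          using \<open>\<forall>c\<in>C. fst c = 0\<close> assms(9) unfolding carr by auto
      qed (use C_q in auto)
      moreover have "{0} \<times> {0..<int q} = {(0, int i) | i. i < q}"
        by (auto intro!: exI[of _ "nat _"])
      ultimately show ?graph
        using graph_of_inj_on_fst[of S\<^sub>0 p q] sub zero(1) S\<^sub>0_p unfolding carr by auto
    next
      assume S\<^sub>0_q: "card S\<^sub>0 = q"
      then have C_p: "card C = p" using prod pos by simp
      have "inj_on snd S\<^sub>0"
        "(\<forall>c\<in>C. \<forall>c'\<in>C. snd c = snd c') \<or> (\<forall>s\<in>S\<^sub>0. \<forall>s'\<in>S\<^sub>0. fst s = fst s')"
        using factorization_Z_prod_prime[OF assms(2-4) factorization_commute[OF F, unfolded G_def]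
            C_p S\<^sub>0_q] by blast+
      moreover from this(2) have "\<forall>c\<in>C. snd c = 0"
        using zero not_axis(1) by (metis fst_conv snd_conv)
      moreover have "C = {0..<int p} \<times> {0}"
      proof (rule card_subset_eq)
        show "C \<subseteq> {0..<int p} \<times> {0}"
          using \<open>\<forall>c\<in>C. snd c = 0\<close> assms(9) unfolding carr by auto
      qed (use C_p in auto)
      moreover have "{0..<int p} \<times> {0} = {(int i, 0) | i. i < p}"
        by (auto intro!: exI[of _ "nat _"])
      ultimately show ?graph
        using graph_of_inj_on_snd[of S\<^sub>0 p q] sub zero(1) S\<^sub>0_q unfolding carr by auto
    qed
  qed
  finally show ?thesis .
qed

end
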